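(* For any rooted tree $T$ with $v(T)\ge2$ we have $$\Delta\psi_T(t)=\psi_{T_1}(t)\psi_{T_2}(t)\cdots\psi_{T_d}(t)=\psi_{T\backslash\{\mathrm{rt}_T\}}(t),$$ where $T_1,\ldots,T_d$ are the connected components of $T\backslash\{\mathrm{rt}_T\}$ and $\Delta g(t)=g(t+1)-g(t)$ for a polynomial $g$.
   Context: A rooted tree is a finite connected acyclic graph with a designated root $\mathrm{rt}_T$. $E(T)$ is the edge set and $v(T)$ the number of vertices. $T\backslash\{\mathrm{rt}_T\}$ is the graph obtained by deleting the root and all edges adjacent to it; each component is a rooted tree, rooted at its vertex closest to $\mathrm{rt}_T$ (a child of $\mathrm{rt}_T$). For $e\in E(T)$ let $T_e$ be the component of $T$ minus the edge $e$ containing $\mathrm{rt}_T$ (rooted at $\mathrm{rt}_T$), and $T'_e$ the other component, rooted at the endpoint of $e$ farther from $\mathrm{rt}_T$. Write $e\succ f$ if $f\in E(T_e)$; $e_1\succ\cdots\succ e_r$ means $e_i\succ e_j$ for all $i<j$. Such a sequence $\vec e$ determines rooted trees $T_{\vec e,1},\ldots,T_{\vec e,r+1}$: put $S_1=T$ and, for $i=1,\ldots,r$, $T_{\vec e,i}=(S_i)'_{e_i}$, $S_{i+1}=(S_i)_{e_i}$; finally $T_{\vec e,r+1}=S_{r+1}$. The numbers $\phi_T\in\mathbb{Q}$ are defined recursively by $\phi_T=1$ if $v(T)=1$ and, for $v(T)\ge2$, $\phi_T=-\sum_{k=2}^{v(T)}\frac{1}{k!}\sum_{\vec e\in E(T)^{k-1},\,e_1\succ\cdots\succ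 e_{k-1}}\phi_{T_{\vec e,1}}\cdots\phi_{T_{\vec e,k}}$. The polynomials $\psi_T(t)\in\mathbb{Q}[t]$ are $$\psi_T(t)=\sum_{k=1}^{v(T)}\frac{t^k}{k!}\sum_{\substack{\vec e\in E(T)^{k-1}\\ e_1\succ\cdots\succ e_{k-1}}}\phi_{T_{\vec e,1}}\cdots\phi_{T_{\vec e,k}},$$ where the inner sum for $k=1$ is $\phi_T$. For a forest $P$ (disjoint union of finitely many rooted trees) with component trees $T_1,\ldots,T_k$, $\psi_P(t)=\prod_{i=1}^k\psi_{T_i}(t)$. *)

theory Defs
  imports "HOL-Computational_Algebra.Polynomial"
begin

section \<open>Simple graphs\<close>

record 'a graph =
  verts :: "'a set"
  edges :: "'a set set"

definition simple_graph :: "('a, 'b) graph_scheme \<Rightarrow> bool" where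
  "simple_graph G \<longleftrightarrow> (\<forall>e\<in>edges G. e \<subseteq> verts G \<and> card e = 2)"

definition adj :: "('a, 'b) graph_scheme \<Rightarrow> ('a \<times> 'a) set" where
  "adj G = {(u, v). {u, v} \<in> edges G}"

definition connected_graph :: "('a, 'b) graph_scheme \<Rightarrow> bool" where
  "connected_graph G \<longleftrightarrow> verts G \<noteq> {} \<and> (\<forall>u\<in>verts G. \<forall>v\<in>verts G. (u, v) \<in> (adj G)\<^sup>*)"

text \<open>The length bound excludes walking back and forth along one edge.  (For the same reason the
  cycles of symmetric digraphs, as in the session Graph\_Theory, are of no use here.)\<close>

definition graph_cycle :: "('a, 'b) graph_scheme \<Rightarrow> 'a list \<Rightarrow> bool" where
  "graph_cycle G vs \<longleftrightarrow> 3 \<le> length vs \<and> distinct vs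
     \<and> successively (\<lambda>u v. {u, v} \<in> edges G) vs \<and> {last vs, hd vs} \<in> edges G"

definition acyclic_graph :: "('a, 'b) graph_scheme \<Rightarrow> bool" where
  "acyclic_graph G \<longleftrightarrow> (\<nexists>vs. graph_cycle G vs)"

text \<open>Only meaningful for vertices in the same component.\<close>

definition graph_dist :: "('a, 'b) graph_scheme \<Rightarrow> 'a \<Rightarrow> 'a \<Rightarrow> nat" where
  "graph_dist G u v = (LEAST n. (u, v) \<in> adj G ^^ n)"

definition component_of :: "('a, 'b) graph_scheme \<Rightarrow> 'a \<Rightarrow> 'a graph" where
  "component_of G v =
     (let C = {u \<in> verts G. (v, u) \<in> (adj G)\<^sup>*} in \<lparr>verts = C, edges = {e \<in> edges G. e \<subseteq> C}\<rparr>)"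

definition graph_components :: "('a, 'b) graph_scheme \<Rightarrow> 'a graph set" where
  "graph_components G = component_of G ` verts G"

definition delete_edge :: "('a, 'b) graph_scheme \<Rightarrow> 'a set \<Rightarrow> 'a graph" where
  "delete_edge G e = \<lparr>verts = verts G, edges = edges G - {e}\<rparr>"

definition delete_vertex :: "('a, 'b) graph_scheme \<Rightarrow> 'a \<Rightarrow> 'a graph" where
  "delete_vertex G v = \<lparr>verts = verts G - {v}, edges = {e \<in> edges G. v \<notin> e}\<rparr>"


section \<open>Rooted trees and forests\<close>

record 'a rooted_graph = "'a graph" +
  rt :: 'a

definition rooted_at :: "('a, 'b) graph_scheme \<Rightarrow> 'a \<Rightarrow> 'a rooted_graph" where
  "rooted_at G r = \<lparr>verts = verts G, edges = edges G, rt = r\<rparr>"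

definition rooted_tree :: "'a rooted_graph \<Rightarrow> bool" where
  "rooted_tree T \<longleftrightarrow> simple_graph T \<and> finite (verts T) \<and> connected_graph T \<and> acyclic_graph T
     \<and> rt T \<in> verts T"

definition vcount :: "'a rooted_graph \<Rightarrow> nat" where
  "vcount T = card (verts T)"

definition far_end :: "'a rooted_graph \<Rightarrow> 'a set \<Rightarrow> 'a" where
  "far_end T e =
     (THE v. v \<in> e \<and> (\<forall>u\<in>e. u \<noteq> v \<longrightarrow> graph_dist T (rt T) u < graph_dist T (rt T) v))"

text \<open>\<open>lower T e\<close> and \<open>upper T e\<close> are the trees $T_e$ and $T'_e$.\<close>

definition lower :: "'a rooted_graph \<Rightarrow> 'a set \<Rightarrow> 'a rooted_graph" where
  "lower T e = rooted_at (component_of (delete_edge T e) (rt T)) (rt T)"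

definition upper :: "'a rooted_graph \<Rightarrow> 'a set \<Rightarrow> 'a rooted_graph" where
  "upper T e = rooted_at (component_of (delete_edge T e) (far_end T e)) (far_end T e)"

text \<open>A rooted forest is a graph together with the set of the roots of its components.\<close>

record 'a rooted_forest = "'a graph" +
  roots :: "'a set"

definition component_trees :: "'a rooted_forest \<Rightarrow> 'a rooted_graph set" where
  "component_trees P = {rooted_at C r |C r. C \<in> graph_components P \<and> r \<in> roots P \<and> r \<in> verts C}"

definition delete_root :: "'a rooted_graph \<Rightarrow> 'a rooted_forest" where
  "delete_root T =
     (let G = delete_vertex T (rt T) in
      \<lparr>verts = verts G, edges = edges G,
       roots = {v. \<exists>C\<in>graph_components G. v \<in> verts C \<and>
         (\<forall>u\<in>verts C. u \<noteq> v \<longrightarrow> graph_dist T (rt T) v < graph_dist T (rt T) u)}\<rparr>)"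


section \<open>Edge sequences and the trees they determine\<close>

definition edge_succ :: "'a rooted_graph \<Rightarrow> 'a set \<Rightarrow> 'a set \<Rightarrow> bool" where
  "edge_succ T e f \<longleftrightarrow> f \<in> edges (lower T e)"

definition edge_seqs :: "'a rooted_graph \<Rightarrow> nat \<Rightarrow> 'a set list set" where
  "edge_seqs T r = {es. length es = r \<and> set es \<subseteq> edges T \<and> sorted_wrt (edge_succ T) es}"

fun cut_trees :: "'a rooted_graph \<Rightarrow> 'a set list \<Rightarrow> 'a rooted_graph list" where
  "cut_trees S [] = [S]"
| "cut_trees S (e # es) = upper S e # cut_trees (lower S e) es"


section \<open>Cutting an edge of a tree produces smaller graphs\<close>

lemma adj_delete_edge: "adj (delete_edge G e) \<subseteq> adj G"
  by (auto simp: adj_def delete_edge_def)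

lemma sym_adj: "sym (adj G)"
  by (auto simp: adj_def sym_def insert_commute)

lemma rtrancl_adj_sym: "(u, v) \<in> (adj G)\<^sup>* \<Longrightarrow> (v, u) \<in> (adj G)\<^sup>*"
  using sym_rtrancl[OF sym_adj] by (meson symD)

lemma verts_lower: "verts (lower T e) = {u \<in> verts T. (rt T, u) \<in> (adj (delete_edge T e))\<^sup>*}"
  by (simp add: lower_def rooted_at_def component_of_def delete_edge_def Let_def)

lemma verts_upper:
  "verts (upper T e) = {u \<in> verts T. (far_end T e, u) \<in> (adj (delete_edge T e))\<^sup>*}"
  by (simp add: upper_def rooted_at_def component_of_def delete_edge_def Let_def)

lemma rtrancl_imp_distinct_path:
  assumes "(u, v) \<in> R\<^sup>*"
  shows "\<exists>vs. vs \<noteq> [] \<and> hd vs = u \<and> last vs = v \<and> distinct vs \<and> successively (\<lambda>x y. (x, y) \<in> R) vs"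
  using assms
proof (induction rule: rtrancl_induct)
  case base
  show ?case by (intro exI[of _ "[u]"]) auto
next
  case (step y z)
  then obtain vs where vs: "vs \<noteq> []" "hd vs = u" "last vs = y" "distinct vs"
    "successively (\<lambda>x y. (x, y) \<in> R) vs" by blast
  show ?case
  proof (cases "z \<in> set vs")
    case True
    then obtain as bs where ab: "vs = as @ z # bs" by (meson split_list)
    show ?thesis
      using vs unfolding ab
      by (intro exI[of _ "as @ [z]"]) (auto simp: successively_append_iff hd_append)
  next
    case False
    then show ?thesis
      using vs step.hyps(2)
      by (intro exI[of _ "vs @ [z]"]) (auto simp: successively_append_iff)
  qed
qed

lemma acyclic_graph_bridge:
  assumes "acyclic_graph G" "{u, v} \<in> edges G" "u \<noteq> v"
  shows "(u, v) \<notin> (adj (delete_edge G {u, v}))\<^sup>*"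
proof
  assume "(u, v) \<in> (adj (delete_edge G {u, v}))\<^sup>*"
  from rtrancl_imp_distinct_path[OF this]
  obtain vs where vs: "vs \<noteq> []" "hd vs = u" "last vs = v" "distinct vs"
    "successively (\<lambda>x y. (x, y) \<in> adj (delete_edge G {u, v})) vs"
    by (elim exE conjE)
  obtain a as where 1: "vs = a # as" using vs(1) by (cases vs) auto
  obtain b bs where 2: "as = b # bs" using vs(2,3) assms(3) 1 by (cases as) auto
  have "bs \<noteq> []"
  proof
    assume "bs = []"
    then have "(u, v) \<in> adj (delete_edge G {u, v})"
      using vs(2,3,5) 1 2 by simp
    then show False by (simp add: adj_def delete_edge_def)
  qed
  then have "3 \<le> length vs"
    using 1 2 by (cases bs) auto
  moreover have "successively (\<lambda>u v. {u, v} \<in> edges G) vs"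
    using vs(5) by (rule successively_mono) (simp add: adj_def delete_edge_def)
  moreover have "{last vs, hd vs} \<in> edges G"
    using assms(2) unfolding vs(2,3) by (simp add: insert_commute)
  ultimately have "graph_cycle G vs"
    using vs(4) by (simp add: graph_cycle_def)
  then show False using assms(1) by (auto simp: acyclic_graph_def)
qed

lemma shortest_walk_avoids:
  assumes "(r, u) \<in> adj G ^^ n" "\<And>m. m < n \<Longrightarrow> (r, u) \<notin> adj G ^^ m"
    and "\<And>m. m < n \<Longrightarrow> (r, v) \<notin> adj G ^^ m"
  shows "(r, u) \<in> (adj (delete_edge G {u, v}))\<^sup>*"
proof -
  have "k \<le> n \<Longrightarrow> (r, w) \<in> adj G ^^ k \<Longrightarrow> (k < n \<or> w = u) \<Longrightarrow>
      (r, w) \<in> (adj (delete_edge G {u, v}))\<^sup>*" for k w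
  proof (induction k arbitrary: w)
    case 0
    then show ?case by simp
  next
    case (Suc k)
    then obtain x where x: "(r, x) \<in> adj G ^^ k" "(x, w) \<in> adj G" by auto
    have "x \<noteq> u" "x \<noteq> v" using x(1) assms(2,3) Suc.prems(1) by auto
    then have "(x, w) \<in> adj (delete_edge G {u, v})"
      using x(2) by (auto simp: adj_def delete_edge_def doubleton_eq_iff)
    then show ?case using Suc.IH[of x] x(1) Suc.prems(1) by (auto intro: rtrancl_into_rtrancl)
  qed
  then show ?thesis using assms(1) by blast
qed

lemma near_reachable:
  assumes "(r, u) \<in> (adj G)\<^sup>*" "(r, v) \<in> (adj G)\<^sup>*" "graph_dist G r u \<le> graph_dist G r v"
  shows "(r, u) \<in> (adj (delete_edge G {u, v}))\<^sup>*"
proof (rule shortest_walk_avoids)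
  show "(r, u) \<in> adj G ^^ graph_dist G r u"
    using assms(1) unfolding graph_dist_def by (auto simp: rtrancl_power intro: LeastI)
  show "(r, u) \<notin> adj G ^^ m" if "m < graph_dist G r u" for m
    using that unfolding graph_dist_def by (rule not_less_Least)
  show "(r, v) \<notin> adj G ^^ m" if "m < graph_dist G r u" for m
    using that assms(3) not_less_Least unfolding graph_dist_def
    by (metis (mono_tags, lifting) order_less_le_trans)
qed

lemma far_end_separated:
  assumes "rooted_tree T" "e \<in> edges T"
  shows "far_end T e \<in> verts T" "(rt T, far_end T e) \<notin> (adj (delete_edge T e))\<^sup>*"
proof -
  let ?d = "graph_dist T (rt T)"
  obtain x y where xy: "e = {x, y}" "x \<noteq> y"
    using assms by (auto simp: rooted_tree_def simple_graph_def card_2_iff)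
  obtain u v where uv: "e = {u, v}" "u \<noteq> v" "?d u \<le> ?d v"
    using xy by (metis insert_commute nat_le_linear)
  have V: "u \<in> verts T" "v \<in> verts T"
    using assms uv by (auto simp: rooted_tree_def simple_graph_def)
  have R: "(rt T, u) \<in> (adj T)\<^sup>*" "(rt T, v) \<in> (adj T)\<^sup>*"
    using assms V by (auto simp: rooted_tree_def connected_graph_def)
  have near: "(rt T, u) \<in> (adj (delete_edge T e))\<^sup>*"
    using near_reachable[OF R uv(3)] uv(1) by simp
  have sep: "(u, v) \<notin> (adj (delete_edge T e))\<^sup>*"
    using acyclic_graph_bridge[of T u v] assms uv by (auto simp: rooted_tree_def)
  then have far: "(rt T, v) \<notin> (adj (delete_edge T e))\<^sup>*"
    using near by (meson rtrancl_adj_sym rtrancl_trans)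
  have "?d u < ?d v"
  proof (rule ccontr)
    assume "\<not> ?d u < ?d v"
    then have "(rt T, v) \<in> (adj (delete_edge T e))\<^sup>*"
      using near_reachable[OF R(2,1)] uv(1) by (simp add: insert_commute)
    with far show False ..
  qed
  then have fe: "far_end T e = v"
    unfolding far_end_def using uv by (intro the_equality) auto
  show "far_end T e \<in> verts T" using V(2) unfolding fe .
  show "(rt T, far_end T e) \<notin> (adj (delete_edge T e))\<^sup>*" using far unfolding fe .
qed

lemma verts_lower_psubset:
  assumes "rooted_tree T" "e \<in> edges T"
  shows "verts (lower T e) \<subset> verts T"
proof -
  have "far_end T e \<notin> verts (lower T e)"
    using far_end_separated(2)[OF assms] by (simp add: verts_lower)
  moreover have "verts (lower T e) \<subseteq> verts T" by (auto simp: verts_lower)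
  ultimately show ?thesis using far_end_separated(1)[OF assms] by blast
qed

lemma verts_upper_psubset:
  assumes "rooted_tree T" "e \<in> edges T"
  shows "verts (upper T e) \<subset> verts T"
proof -
  have "rt T \<notin> verts (upper T e)"
    using far_end_separated(2)[OF assms] by (auto simp: verts_upper dest: rtrancl_adj_sym)
  moreover have "verts (upper T e) \<subseteq> verts T" by (auto simp: verts_upper)
  ultimately show ?thesis using assms(1) by (auto simp: rooted_tree_def)
qed

lemma verts_cut_trees_subset: "S \<in> set (cut_trees T es) \<Longrightarrow> verts S \<subseteq> verts T"
proof (induction es arbitrary: T)
  case (Cons e es)
  then show ?case using verts_lower verts_upper by fastforce
qed simp

lemma vcount_cut_trees_less:
  assumes "rooted_tree T" "es \<in> edge_seqs T k" "0 < k" "S \<in> set (cut_trees T es)"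
  shows "vcount S < vcount T"
proof -
  obtain e es' where es: "es = e # es'" "e \<in> edges T"
    using assms(2,3) by (cases es) (auto simp: edge_seqs_def)
  have "verts S \<subset> verts T"
    using assms(4) verts_cut_trees_subset[of S "lower T e" es']
      verts_lower_psubset[OF assms(1) es(2)] verts_upper_psubset[OF assms(1) es(2)]
    by (auto simp: es(1))
  then show ?thesis
    using assms(1) by (auto simp: vcount_def rooted_tree_def intro: psubset_card_mono)
qed


section \<open>The numbers $\phi_T$ and the polynomials $\psi_T$\<close>

text \<open>The value 0 on graphs that are not rooted trees is arbitrary.\<close>

function tree_phi :: "'a rooted_graph \<Rightarrow> rat" where
  "tree_phi T =
     (if \<not> rooted_tree T then 0
      else if vcount T = 1 then 1
      else - (\<Sum>k = 2..vcount T. 1 / fact k *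
               (\<Sum>es\<in>edge_seqs T (k - 1). prod_list (map tree_phi (cut_trees T es)))))"
  by auto
termination
  by (relation "measure vcount") (auto intro: vcount_cut_trees_less)

declare tree_phi.simps [simp del]

definition tree_psi :: "'a rooted_graph \<Rightarrow> rat poly" where
  "tree_psi T =
     (\<Sum>k = 1..vcount T. monom (1 / fact k *
        (\<Sum>es\<in>edge_seqs T (k - 1). prod_list (map tree_phi (cut_trees T es)))) k)"

definition forest_psi :: "'a rooted_forest \<Rightarrow> rat poly" where
  "forest_psi P = (\<Prod>T\<in>component_trees P. tree_psi T)"

definition forward_diff :: "rat poly \<Rightarrow> rat poly" where
  "forward_diff g = pcompose g [:1, 1:] - g"

end

theory Submission
  imports Defs
begin

text \<open>
  Write $\psi_T'$ for the derivative of $\psi_T$. The idea is to compare derivatives. A nonempty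
  sequence $e_1 \succ \cdots \succ e_r$ in $T$ consists of an edge $e_1 = e$ and a sequence in
  $T_e$, and the tree that is cut off first is $T'_e$. Since differentiation turns
  $t^{k+1}/(k+1)!$ into $t^k/k!$, this gives (\<open>pderiv_tree_psi\<close>)
  \[ \psi_T' = \phi_T + \sum_{e \in E(T)} \phi_{T'_e}\, \psi_{T_e}. \]
  The operator $\Delta$ commutes with differentiation and kills the constant $\phi_T$, so
  $(\Delta\psi_T)' = \sum_e \phi_{T'_e}\, \Delta\psi_{T_e}$.

  Let $\beta_T$ be the product of the $\psi$ of the branches of $T$ at its root. It satisfies the
  same recursion, $\beta_T' = \sum_e \phi_{T'_e}\, \beta_{T_e}$ (\<open>pderiv_branch_psi\<close>). Indeed,
  differentiate the factor of one branch $B$ with the formula above. Its constant term $\phi_B$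
  is the summand of the edge joining $B$ to the root, because cutting that edge removes exactly
  $B$; and the summand of an edge $e$ of $B$ replaces the branch $B$ by $B_e$, which is what
  cutting $e$ in $T$ does to the branches. Every edge of $T$ is either adjacent to the root or
  lies in exactly one branch.

  By induction on $v(T)$ the derivatives of $\Delta\psi_T$ and $\beta_T$ agree, so it remains to
  compare values at $0$. As $\psi_T(0) = 0$, the first value is $\psi_T(1)$, and the recursion
  defining $\phi_T$ says precisely that this is $1$ for the one-vertex tree and $0$ otherwise;
  the value $\beta_T(0)$ is an empty product for the one-vertex tree and has a vanishing factor
  otherwise. Including the one-vertex tree in the induction makes a case distinction on $T_e$
  unnecessary.

  The graph-theoretic input is that cuts at different edges commute (\<open>cut_nested\<close>,
  \<open>cut_incomparable_or_nested\<close>). It follows from one principle: if $T$ is written as two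
  disjoint connected graphs joined by an edge $e$, then these two graphs are $T_e$ and $T'_e$
  (\<open>graft_unique\<close>).
\<close>

section \<open>Splitting a rooted tree at an edge\<close>

lemma adj_mono: "edges H \<subseteq> edges G \<Longrightarrow> adj H \<subseteq> adj G"
  by (auto simp: adj_def)

lemma connected_from:
  assumes "x \<in> verts G" "\<And>u. u \<in> verts G \<Longrightarrow> (x, u) \<in> (adj G)\<^sup>*"
  shows "connected_graph G"
  unfolding connected_graph_def using assms by (blast intro: rtrancl_trans rtrancl_adj_sym)

text \<open>A walk cannot leave a subgraph that no further edge meets.\<close>

lemma component_of_eq:
  assumes "simple_graph G" "simple_graph H" "connected_graph H"
    and "verts H \<subseteq> verts G" "edges H \<subseteq> edges G" "x \<in> verts H"
    and closed: "\<And>f. f \<in> edges G \<Longrightarrow> f \<inter> verts H \<noteq> {} \<Longrightarrow> f \<in> edges H"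
  shows "component_of G x = \<lparr>verts = verts H, edges = edges H\<rparr>"
proof -
  have "u \<in> verts H" if "(x, u) \<in> (adj G)\<^sup>*" for u
    using that
  proof (induction rule: rtrancl_induct)
    case base
    show ?case by (fact assms(6))
  next
    case (step y z)
    then have "{y, z} \<in> edges H" using closed[of "{y, z}"] by (auto simp: adj_def)
    then show ?case using assms(2) by (auto simp: simple_graph_def)
  qed
  moreover have "(x, u) \<in> (adj G)\<^sup>*" if "u \<in> verts H" for u
    using that assms(3,6) rtrancl_mono[OF adj_mono[OF assms(5)]]
    by (auto simp: connected_graph_def)
  ultimately have V: "{u \<in> verts G. (x, u) \<in> (adj G)\<^sup>*} = verts H"
    using assms(4) by blast
  have "{f \<in> edges G. f \<subseteq> verts H} = edges H"
  proof (intro equalityI subsetI)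
    fix f assume f: "f \<in> {f \<in> edges G. f \<subseteq> verts H}"
    then have "f \<noteq> {}" using assms(1) by (auto simp: simple_graph_def)
    with f show "f \<in> edges H" by (intro closed) auto
  next
    fix f assume "f \<in> edges H"
    then show "f \<in> {f \<in> edges G. f \<subseteq> verts H}"
      using assms(2,5) by (auto simp: simple_graph_def)
  qed
  with V show ?thesis by (simp add: component_of_def)
qed

lemma connected_component_of:
  assumes "x \<in> verts G" "simple_graph G"
  shows "connected_graph (component_of G x)"
proof -
  let ?C = "component_of G x"
  have V: "verts ?C = {u \<in> verts G. (x, u) \<in> (adj G)\<^sup>*}"
    and E: "edges ?C = {f \<in> edges G. f \<subseteq> verts ?C}"
    by (simp_all add: component_of_def Let_def)
  have "u \<in> verts G \<and> (x, u) \<in> (adj ?C)\<^sup>*" if "(x, u) \<in> (adj G)\<^sup>*" for u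
    using that
  proof (induction rule: rtrancl_induct)
    case base
    show ?case using assms by simp
  next
    case (step y z)
    then have yz: "{y, z} \<in> edges G" "z \<in> verts G"
      using assms(2) by (auto simp: adj_def simple_graph_def)
    have "(x, z) \<in> (adj G)\<^sup>*" using step.hyps by (rule rtrancl_into_rtrancl)
    then have "{y, z} \<in> edges ?C" using yz step by (simp add: E V)
    then have "(y, z) \<in> adj ?C" by (simp add: adj_def)
    with step.IH yz show ?case by (auto intro: rtrancl_into_rtrancl)
  qed
  then have "(x, u) \<in> (adj ?C)\<^sup>*" if "u \<in> verts ?C" for u using that V by auto
  then show ?thesis
    using assms(1) V by (intro connected_from[of x]) auto
qed

lemma acyclic_subgraph:
  assumes "acyclic_graph G" "edges H \<subseteq> edges G"
  shows "acyclic_graph H"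
proof -
  have "graph_cycle G vs" if "graph_cycle H vs" for vs
  proof -
    have "successively (\<lambda>u v. {u, v} \<in> edges H) vs" using that by (simp add: graph_cycle_def)
    then have "successively (\<lambda>u v. {u, v} \<in> edges G) vs"
      by (rule successively_mono) (use assms(2) in blast)
    with that assms(2) show ?thesis by (auto simp: graph_cycle_def)
  qed
  with assms(1) show ?thesis by (auto simp: acyclic_graph_def)
qed

lemma simple_delete_edge: "simple_graph G \<Longrightarrow> simple_graph (delete_edge G e)"
  by (auto simp: simple_graph_def delete_edge_def)

lemma simple_delete_vertex: "simple_graph G \<Longrightarrow> simple_graph (delete_vertex G v)"
  by (auto simp: simple_graph_def delete_vertex_def)

text \<open>Together with \<open>far_end_separated\<close>, this locates both ends of an edge relative to the root.
  The end that is no farther from the root is reached by a shortest walk, which avoids the edge;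
  the other end is then separated from the root because the edge is a bridge.\<close>

lemma near_end_reachable:
  assumes "rooted_tree T" "e \<in> edges T"
  obtains a b where "far_end T e = b" "e = {a, b}" "(rt T, a) \<in> (adj (delete_edge T e))\<^sup>*"
proof -
  let ?d = "graph_dist T (rt T)"
  obtain x y where xy: "e = {x, y}" "x \<noteq> y"
    using assms by (auto simp: rooted_tree_def simple_graph_def card_2_iff)
  obtain u v where uv: "e = {u, v}" "u \<noteq> v" "?d u \<le> ?d v"
    using xy by (metis insert_commute nat_le_linear)
  have "u \<in> verts T" "v \<in> verts T"
    using assms uv by (auto simp: rooted_tree_def simple_graph_def)
  then have R: "(rt T, u) \<in> (adj T)\<^sup>*" "(rt T, v) \<in> (adj T)\<^sup>*"
    using assms by (auto simp: rooted_tree_def connected_graph_def)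
  have near: "(rt T, u) \<in> (adj (delete_edge T e))\<^sup>*"
    using near_reachable[OF R uv(3)] uv(1) by simp
  have "(u, v) \<notin> (adj (delete_edge T e))\<^sup>*"
    using acyclic_graph_bridge[of T u v] assms uv by (auto simp: rooted_tree_def)
  then have far: "(rt T, v) \<notin> (adj (delete_edge T e))\<^sup>*"
    using near by (meson rtrancl_adj_sym rtrancl_trans)
  have "?d u < ?d v"
    using near_reachable[OF R(2,1)] uv(1) far by (force simp: insert_commute not_less)
  then have "far_end T e = v"
    unfolding far_end_def using uv by (intro the_equality) auto
  from this uv(1) near show ?thesis by (intro that[of v u])
qed

text \<open>The tree \<open>T\<close> arises from \<open>A\<close> and \<open>B\<close> by joining the root of \<open>B\<close> to a vertex of \<open>A\<close> by the
  edge \<open>e\<close>. In contrast to the definitions of \<open>lower\<close> and \<open>upper\<close>, this involves neither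
  distances nor reachability after a deletion, so graftings can be regrouped by elementary set
  algebra.\<close>

definition is_graft :: "'a rooted_graph \<Rightarrow> 'a set \<Rightarrow> 'a rooted_graph \<Rightarrow> 'a rooted_graph \<Rightarrow> bool" where
  "is_graft T e A B \<longleftrightarrow> simple_graph A \<and> simple_graph B \<and> connected_graph A \<and> connected_graph B
     \<and> rt A \<in> verts A \<and> rt B \<in> verts B \<and> verts A \<inter> verts B = {}
     \<and> verts T = verts A \<union> verts B \<and> edges T = insert e (edges A \<union> edges B) \<and> rt T = rt A
     \<and> (\<exists>a\<in>verts A. e = {a, rt B})"

lemma graft_edges_distinct:
  assumes "is_graft T e A B"
  shows "e \<notin> edges A" "e \<notin> edges B" "edges A \<inter> edges B = {}"
proof -
  have sub: "f \<subseteq> verts A \<and> f \<noteq> {}" if "f \<in> edges A" for f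
    using assms that by (force simp: is_graft_def simple_graph_def)
  have sub': "f \<subseteq> verts B" if "f \<in> edges B" for f
    using assms that by (force simp: is_graft_def simple_graph_def)
  have e: "\<not> e \<subseteq> verts A" "\<not> e \<subseteq> verts B" "verts A \<inter> verts B = {}"
    using assms by (auto simp: is_graft_def)
  show "e \<notin> edges A" "e \<notin> edges B" using sub sub' e by blast+
  show "edges A \<inter> edges B = {}" using sub sub' e(3) by blast
qed

lemma connected_graft:
  assumes "connected_graph A" "connected_graph B" "a \<in> verts A" "b \<in> verts B"
    and "verts T = verts A \<union> verts B" "edges T = insert {a, b} (edges A \<union> edges B)"
  shows "connected_graph T"
proof -
  have A: "(u, v) \<in> (adj T)\<^sup>*" if "u \<in> verts A" "v \<in> verts A" for u v
    using that assms(1,6) rtrancl_mono[OF adj_mono[of A T]] by (auto simp: connected_graph_def)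
  have B: "(u, v) \<in> (adj T)\<^sup>*" if "u \<in> verts B" "v \<in> verts B" for u v
    using that assms(2,6) rtrancl_mono[OF adj_mono[of B T]] by (auto simp: connected_graph_def)
  have ab: "(a, b) \<in> adj T" using assms(6) by (simp add: adj_def)
  have "(a, v) \<in> (adj T)\<^sup>*" if "v \<in> verts T" for v
    using that A[of a v] B[of b v] ab assms(3,4,5) by (auto intro: converse_rtrancl_into_rtrancl)
  then show ?thesis
    using assms(3,5) by (intro connected_from[of a]) auto
qed

text \<open>\<open>A\<close> and \<open>B\<close> are the components of \<open>T\<close> minus \<open>e\<close>. The end of \<open>e\<close> in \<open>A\<close> is still connected
  to the root, so the far end of \<open>e\<close> must be the root of \<open>B\<close>.\<close>

lemma graft_unique:
  assumes T: "rooted_tree T" and gr: "is_graft T e A B"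
  shows "lower T e = A" "upper T e = B"
proof -
  let ?G = "delete_edge T e"
  have e: "e \<in> edges T" using gr by (simp add: is_graft_def)
  have G: "simple_graph ?G" using T by (simp add: rooted_tree_def simple_delete_edge)
  have VG: "verts ?G = verts A \<union> verts B" and EG: "edges ?G = edges A \<union> edges B"
    using gr graft_edges_distinct[OF gr] by (auto simp: delete_edge_def is_graft_def)
  have gr': "simple_graph A" "simple_graph B" "connected_graph A" "connected_graph B"
      "rt A \<in> verts A" "rt B \<in> verts B" "verts A \<inter> verts B = {}" "rt T = rt A"
    using gr by (simp_all add: is_graft_def)
  have sub: "f \<subseteq> verts A" if "f \<in> edges A" for f
    using gr'(1) that by (auto simp: simple_graph_def)
  have sub': "f \<subseteq> verts B" if "f \<in> edges B" for f
    using gr'(2) that by (auto simp: simple_graph_def)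
  have A: "component_of ?G x = \<lparr>verts = verts A, edges = edges A\<rparr>" if "x \<in> verts A" for x
    using that by (rule component_of_eq[rotated 5]) (use G gr' VG EG sub' in \<open>simp_all, blast\<close>)
  have B: "component_of ?G x = \<lparr>verts = verts B, edges = edges B\<rparr>" if "x \<in> verts B" for x
    using that by (rule component_of_eq[rotated 5]) (use G gr' VG EG sub in \<open>simp_all, blast\<close>)
  show "lower T e = A"
    using A[OF gr'(5)] gr'(8) by (simp add: lower_def rooted_at_def)
  obtain a where a: "a \<in> verts A" "e = {a, rt B}" using gr by (auto simp: is_graft_def)
  have "far_end T e \<in> e" using near_end_reachable[OF T e] by auto
  moreover have "far_end T e \<notin> verts A"
  proof
    assume "far_end T e \<in> verts A"
    then have "(rt A, far_end T e) \<in> (adj A)\<^sup>*" using gr'(3,5) by (auto simp: connected_graph_def)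
    then have "(rt T, far_end T e) \<in> (adj ?G)\<^sup>*"
      using rtrancl_mono[OF adj_mono[of A ?G]] EG gr'(8) by auto
    with far_end_separated(2)[OF T e] show False ..
  qed
  ultimately have "far_end T e = rt B" using a by auto
  then show "upper T e = B" using B[OF gr'(6)] by (simp add: upper_def rooted_at_def)
qed

text \<open>A walk from the root either avoids \<open>e\<close> or continues from one of its ends, so every vertex
  is still connected to the root or to the far end of \<open>e\<close>, and no vertex to both.\<close>

lemma is_graft_lower_upper:
  assumes T: "rooted_tree T" and e: "e \<in> edges T"
  shows "is_graft T e (lower T e) (upper T e)"
proof -
  let ?G = "delete_edge T e"
  let ?A = "lower T e" and ?B = "upper T e"
  obtain a b where fe: "far_end T e = b" and a: "e = {a, b}" "(rt T, a) \<in> (adj ?G)\<^sup>*"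
    using near_end_reachable[OF T e] .
  have sT: "simple_graph T" and sG: "simple_graph ?G"
    and rV: "rt T \<in> verts T" and con: "connected_graph T"
    using T by (simp_all add: rooted_tree_def simple_delete_edge)
  have VG: "verts ?G = verts T" and EG: "edges ?G = edges T - {e}" by (simp_all add: delete_edge_def)
  have b: "b \<in> verts T" "(rt T, b) \<notin> (adj ?G)\<^sup>*" using far_end_separated[OF T e] by (simp_all add: fe)
  have "e \<subseteq> verts T" using sT e by (simp add: simple_graph_def)
  then have aV: "a \<in> verts T" using a(1) by simp
  have EA: "edges ?A = {f \<in> edges T - {e}. f \<subseteq> verts ?A}"
    and EB: "edges ?B = {f \<in> edges T - {e}. f \<subseteq> verts ?B}"
    by (simp_all add: lower_def upper_def component_of_def Let_def rooted_at_def EG)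
  have disj: "verts ?A \<inter> verts ?B = {}"
  proof -
    have False if "u \<in> verts ?A" "u \<in> verts ?B" for u
    proof -
      have "(rt T, u) \<in> (adj ?G)\<^sup>*" "(u, b) \<in> (adj ?G)\<^sup>*"
        using that by (simp_all add: verts_lower verts_upper fe rtrancl_adj_sym)
      with b(2) show False by (meson rtrancl_trans)
    qed
    then show ?thesis by blast
  qed
  have "(rt T, u) \<in> (adj ?G)\<^sup>* \<or> (b, u) \<in> (adj ?G)\<^sup>*" if "(rt T, u) \<in> (adj T)\<^sup>*" for u
    using that
  proof (induction rule: rtrancl_induct)
    case (step y z)
    show ?case
    proof (cases "{y, z} = e")
      case True
      then show ?thesis using a by (auto simp: doubleton_eq_iff)
    next
      case False
      then have "(y, z) \<in> adj ?G" using step.hyps(2) by (simp add: adj_def EG)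
      then show ?thesis using step.IH by (auto intro: rtrancl_into_rtrancl)
    qed
  qed simp
  then have V: "verts T = verts ?A \<union> verts ?B"
    using con rV unfolding verts_lower verts_upper fe connected_graph_def by blast
  have "f \<subseteq> verts ?A \<or> f \<subseteq> verts ?B" if f: "f \<in> edges T" "f \<noteq> e" for f
  proof -
    obtain x y where xy: "f = {x, y}" using sT f(1) by (auto simp: simple_graph_def card_2_iff)
    have "x \<in> verts T" "y \<in> verts T" using sT f(1) xy by (auto simp: simple_graph_def)
    have "(x, y) \<in> adj ?G" "(y, x) \<in> adj ?G"
      using f xy by (auto simp: adj_def EG insert_commute)
    then have "(w, x) \<in> (adj ?G)\<^sup>* \<longleftrightarrow> (w, y) \<in> (adj ?G)\<^sup>*" for w
      by (meson rtrancl_into_rtrancl)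
    then have "x \<in> verts ?A \<longleftrightarrow> y \<in> verts ?A" "x \<in> verts ?B \<longleftrightarrow> y \<in> verts ?B"
      using \<open>x \<in> verts T\<close> \<open>y \<in> verts T\<close> by (simp_all add: verts_lower verts_upper)
    with \<open>x \<in> verts T\<close> V show ?thesis by (auto simp: xy)
  qed
  then have E: "edges T = insert e (edges ?A \<union> edges ?B)" unfolding EA EB using e by blast
  have cA: "connected_graph ?A"
    using connected_component_of[OF _ sG, of "rt T"] rV VG
    by (simp add: lower_def rooted_at_def connected_graph_def adj_def)
  have cB: "connected_graph ?B"
    using connected_component_of[OF _ sG, of b] b(1) VG
    by (simp add: upper_def fe rooted_at_def connected_graph_def adj_def)
  have rts: "rt ?A = rt T" "rt ?B = b" by (simp_all add: lower_def upper_def rooted_at_def fe)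
  have "simple_graph ?A" "simple_graph ?B"
    using sT EA EB by (auto simp: simple_graph_def)
  moreover have "rt T \<in> verts ?A" "b \<in> verts ?B" "a \<in> verts ?A"
    using rV b(1) aV a(2) by (auto simp: verts_lower verts_upper fe)
  ultimately show ?thesis
    using cA cB disj V E a(1) unfolding is_graft_def rts by blast
qed

lemma rooted_tree_lower:
  assumes "rooted_tree T" "e \<in> edges T"
  shows "rooted_tree (lower T e)"
  using is_graft_lower_upper[OF assms] assms(1) acyclic_subgraph[of T "lower T e"]
  by (auto simp: rooted_tree_def is_graft_def)

lemma rooted_tree_upper:
  assumes "rooted_tree T" "e \<in> edges T"
  shows "rooted_tree (upper T e)"
  using is_graft_lower_upper[OF assms] assms(1) acyclic_subgraph[of T "upper T e"]
  by (auto simp: rooted_tree_def is_graft_def)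

lemma vcount_lower_less:
  assumes "rooted_tree T" "e \<in> edges T"
  shows "vcount (lower T e) < vcount T"
  using verts_lower_psubset[OF assms] assms(1)
  by (auto simp: vcount_def rooted_tree_def intro: psubset_card_mono)

lemma finite_edges: "rooted_tree T \<Longrightarrow> finite (edges T)"
  by (rule finite_subset[of _ "Pow (verts T)"]) (auto simp: rooted_tree_def simple_graph_def)


section \<open>Cutting two edges\<close>

definition glue :: "'a rooted_graph \<Rightarrow> 'a set \<Rightarrow> 'a rooted_graph \<Rightarrow> 'a rooted_graph" where
  "glue A e B = \<lparr>verts = verts A \<union> verts B, edges = insert e (edges A \<union> edges B), rt = rt A\<rparr>"

lemma is_graft_connected: "is_graft T e A B \<Longrightarrow> connected_graph T"
  by (auto simp: is_graft_def intro: connected_graft)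

lemma is_graft_simple: "is_graft T e A B \<Longrightarrow> simple_graph T"
  by (auto simp: is_graft_def simple_graph_def card_insert_if)

text \<open>If \<open>e\<close> lies below \<open>f\<close>, then \<open>T\<close> consists of three pieces \<open>A\<close>, \<open>C\<close>, \<open>B\<close> in a row, joined by
  \<open>f\<close> and \<open>e\<close>. Regrouping \<open>A + (C + B)\<close> as \<open>(A + C) + B\<close> and applying \<open>graft_unique\<close> reads off
  the result of cutting \<open>e\<close> first.\<close>

lemma cut_nested:
  assumes T: "rooted_tree T" and f: "f \<in> edges T" and e: "e \<in> edges (upper T f)"
  shows "f \<in> edges (lower T e)" "upper T e = upper (upper T f) e"
    "lower (lower T e) f = lower T f" "upper (lower T e) f = lower (upper T f) e"
proof -
  let ?A = "lower T f" and ?C = "lower (upper T f) e" and ?B = "upper (upper T f) e"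
  let ?D = "glue ?A f ?C"
  have 1: "is_graft T f ?A (upper T f)" using is_graft_lower_upper[OF T f] .
  have 2: "is_graft (upper T f) e ?C ?B"
    using is_graft_lower_upper[OF rooted_tree_upper[OF T f] e] .
  have D: "is_graft ?D f ?A ?C" using 1 2 by (auto simp: is_graft_def glue_def)
  have 3: "is_graft T e ?D ?B"
    using 1 2 is_graft_connected[OF D] is_graft_simple[OF D] by (auto simp: is_graft_def glue_def)
  have "e \<in> edges T" using 1 e by (auto simp: is_graft_def)
  note DT = graft_unique[OF T 3] rooted_tree_lower[OF T this]
  show "f \<in> edges (lower T e)" "upper T e = ?B" using DT by (auto simp: glue_def)
  show "lower (lower T e) f = ?A" "upper (lower T e) f = ?C"
    using graft_unique[OF _ D] DT by auto
qed

text \<open>Here \<open>e\<close> splits the lower part of \<open>f\<close> into \<open>A\<close> and \<open>B\<close>, and the upper part \<open>C\<close> of \<open>f\<close> is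
  attached to one of them. If it is attached to \<open>A\<close>, then \<open>e\<close> and \<open>f\<close> are incomparable and \<open>T\<close>
  regroups as \<open>(A + C) + B\<close>; if it is attached to \<open>B\<close>, then \<open>f\<close> lies below \<open>e\<close> and \<open>T\<close> regroups
  as \<open>A + (B + C)\<close>.\<close>

lemma cut_incomparable_or_nested:
  assumes T: "rooted_tree T" and f: "f \<in> edges T" and e: "e \<in> edges (lower T f)"
  shows "f \<in> edges (upper T e) \<or>
    f \<in> edges (lower T e) \<and> upper T e = upper (lower T f) e \<and>
    lower (lower T e) f = lower (lower T f) e \<and> upper (lower T e) f = upper T f"
proof -
  let ?A = "lower (lower T f) e" and ?B = "upper (lower T f) e" and ?C = "upper T f"
  have 1: "is_graft T f (lower T f) ?C" using is_graft_lower_upper[OF T f] .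
  have 2: "is_graft (lower T f) e ?A ?B"
    using is_graft_lower_upper[OF rooted_tree_lower[OF T f] e] .
  have eT: "e \<in> edges T" using 1 e by (auto simp: is_graft_def)
  obtain a where a: "a \<in> verts ?A \<union> verts ?B" "f = {a, rt ?C}"
    using 1 2 by (auto simp: is_graft_def)
  show ?thesis
  proof (cases "a \<in> verts ?A")
    case True
    let ?D = "glue ?A f ?C"
    have D: "is_graft ?D f ?A ?C" using 1 2 True a(2) by (auto simp: is_graft_def glue_def)
    have 3: "is_graft T e ?D ?B"
      using 1 2 is_graft_connected[OF D] is_graft_simple[OF D] by (auto simp: is_graft_def glue_def)
    note DT = graft_unique[OF T 3] rooted_tree_lower[OF T eT]
    then have "f \<in> edges (lower T e)" by (auto simp: glue_def)
    with DT graft_unique[OF _ D] show ?thesis by auto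
  next
    case False
    let ?D = "glue ?B f ?C"
    have D: "is_graft ?D f ?B ?C" using 1 2 False a by (auto simp: is_graft_def glue_def)
    have 3: "is_graft T e ?A ?D"
      using 1 2 is_graft_connected[OF D] is_graft_simple[OF D] by (auto simp: is_graft_def glue_def)
    from graft_unique[OF T 3] show ?thesis by (auto simp: glue_def)
  qed
qed


lemma upper_lower_eq:
  assumes T: "rooted_tree T" and e: "e \<in> edges T" and s: "s \<in> edges (lower T e)"
    and "e \<notin> edges (upper T s)"
  shows "upper (lower T e) s = upper T s"
  using cut_incomparable_or_nested[OF T e s] assms(4) by auto

text \<open>The relation \<open>\<succ>\<close> of \<open>lower T e\<close> is the restriction of that of \<open>T\<close>. This is what allows
  sequences to be treated by recursion on the tree.\<close>

lemma lower_lower_edges: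
  assumes T: "rooted_tree T" and e: "e \<in> edges T"
    and f: "f \<in> edges (lower T e)" and g: "g \<in> edges (lower T e)"
  shows "g \<in> edges (lower (lower T e) f) \<longleftrightarrow> g \<in> edges (lower T f)"
proof -
  note gr = is_graft_lower_upper[OF T e]
  have fT: "f \<in> edges T" using gr f by (auto simp: is_graft_def)
  from cut_incomparable_or_nested[OF T e f] show ?thesis
  proof (elim disjE conjE)
    assume "e \<in> edges (upper T f)"
    from cut_nested(3)[OF T fT this] show ?thesis by simp
  next
    assume *: "e \<in> edges (lower T f)" "upper (lower T f) e = upper T e"
      "lower (lower T f) e = lower (lower T e) f"
    have "is_graft (lower T f) e (lower (lower T e) f) (upper T e)"
      using is_graft_lower_upper[OF rooted_tree_lower[OF T fT] *(1)] *(2,3) by metis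
    then have "edges (lower T f) = insert e (edges (lower (lower T e) f) \<union> edges (upper T e))"
      by (auto simp: is_graft_def)
    with g graft_edges_distinct[OF gr] show ?thesis by auto
  qed
qed


section \<open>The branches at the root\<close>

definition root_edges :: "'a rooted_graph \<Rightarrow> 'a set set" where
  "root_edges T = {e \<in> edges T. rt T \<in> e}"

lemma root_edges_subset: "r \<in> root_edges T \<Longrightarrow> r \<in> edges T"
  by (simp add: root_edges_def)

lemma finite_root_edges: "rooted_tree T \<Longrightarrow> finite (root_edges T)"
  using finite_edges[of T] by (simp add: root_edges_def)

lemma edge_subset_verts: "rooted_tree T \<Longrightarrow> e \<in> edges T \<Longrightarrow> e \<subseteq> verts T \<and> e \<noteq> {}"
  by (force simp: rooted_tree_def simple_graph_def)

lemma root_notin_upper: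
  assumes "rooted_tree T" "e \<in> edges T"
  shows "rt T \<notin> verts (upper T e)"
  using is_graft_lower_upper[OF assms] by (auto simp: is_graft_def)

lemma edge_in_upper:
  assumes "rooted_tree T" "r \<in> edges T" "f \<in> edges T" "f \<noteq> r" "f \<inter> verts (upper T r) \<noteq> {}"
  shows "f \<in> edges (upper T r)"
proof -
  note gr = is_graft_lower_upper[OF assms(1,2)]
  then have "f \<in> edges (lower T r) \<or> f \<in> edges (upper T r)"
    using assms(3,4) by (auto simp: is_graft_def)
  moreover have "f \<notin> edges (lower T r)"
    using gr assms(5) edge_subset_verts[OF rooted_tree_lower[OF assms(1,2)], of f]
    by (auto simp: is_graft_def)
  ultimately show ?thesis by simp
qed

lemma root_edge_eq:
  assumes T: "rooted_tree T" and r: "r \<in> root_edges T"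
  obtains c where "rt (upper T r) = c" "r = {rt T, c}" "c \<in> verts (upper T r)" "c \<noteq> rt T"
proof -
  have rT: "r \<in> edges T" and "rt T \<in> r" using r by (auto simp: root_edges_def)
  obtain a c where ac: "rt (upper T r) = c" "c \<in> verts (upper T r)" "r = {a, c}"
    using is_graft_lower_upper[OF T rT] unfolding is_graft_def by blast
  moreover from ac have "c \<noteq> rt T" using root_notin_upper[OF T rT] by metis
  moreover from this have "a = rt T" using \<open>rt T \<in> r\<close> ac by simp
  ultimately show ?thesis using that by blast
qed

lemma root_edges_lower:
  assumes T: "rooted_tree T" and e: "e \<in> edges T"
  shows "root_edges (lower T e) = root_edges T - {e}"
proof -
  note gr = is_graft_lower_upper[OF T e]
  have E: "edges T = insert e (edges (lower T e) \<union> edges (upper T e))" "rt (lower T e) = rt T"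
    using gr by (auto simp: is_graft_def)
  have "rt T \<notin> f" if "f \<in> edges (upper T e)" for f
    using edge_subset_verts[OF rooted_tree_upper[OF T e] that] root_notin_upper[OF T e] by blast
  then show ?thesis using E graft_edges_distinct[OF gr] by (auto simp: root_edges_def)
qed

lemma root_edge_notin_upper:
  assumes T: "rooted_tree T" and "r \<in> root_edges T" "e \<in> edges T"
  shows "r \<notin> edges (upper T e)"
  using assms(2) edge_subset_verts[OF rooted_tree_upper[OF T assms(3)], of r]
    root_notin_upper[OF T assms(3)]
  by (auto simp: root_edges_def)

lemma branches_disjoint:
  assumes T: "rooted_tree T" and r: "r \<in> root_edges T" and s: "s \<in> root_edges T" and "r \<noteq> s"
  shows "verts (upper T r) \<inter> verts (upper T s) = {}" "edges (upper T r) \<inter> edges (upper T s) = {}"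
proof -
  have rT: "r \<in> edges T" and sT: "s \<in> edges T" using r s by (simp_all add: root_edges_subset)
  have sl: "s \<in> edges (lower T r)"
    using root_edges_lower[OF T rT] s \<open>r \<noteq> s\<close> by (auto simp: root_edges_def)
  have "upper T s = upper (lower T r) s"
    using upper_lower_eq[OF T rT sl] root_edge_notin_upper[OF T r sT] by simp
  then have "verts (upper T s) \<subseteq> verts (lower T r)"
    using is_graft_lower_upper[OF rooted_tree_lower[OF T rT] sl] by (auto simp: is_graft_def)
  then show V: "verts (upper T r) \<inter> verts (upper T s) = {}"
    using is_graft_lower_upper[OF T rT] by (auto simp: is_graft_def)
  show "edges (upper T r) \<inter> edges (upper T s) = {}"
    using V edge_subset_verts[OF rooted_tree_upper[OF T rT]]
      edge_subset_verts[OF rooted_tree_upper[OF T sT]] by blast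
qed

text \<open>Along a walk from the root, the first edge leads into a branch, and an edge that avoids
  the root cannot leave a branch.\<close>

lemma branches_cover:
  assumes T: "rooted_tree T" and v: "v \<in> verts T" "v \<noteq> rt T"
  shows "\<exists>r\<in>root_edges T. v \<in> verts (upper T r)"
proof -
  have "(rt T, v) \<in> (adj T)\<^sup>*" using T v(1) by (auto simp: rooted_tree_def connected_graph_def)
  then have "v \<noteq> rt T \<longrightarrow> ?thesis"
  proof (induction rule: rtrancl_induct)
    case (step y z)
    have yz: "{y, z} \<in> edges T" using step.hyps(2) by (simp add: adj_def)
    show ?case
    proof
      assume z: "z \<noteq> rt T"
      show "\<exists>r\<in>root_edges T. z \<in> verts (upper T r)"
      proof (cases "y = rt T")
        case True
        then have r: "{y, z} \<in> root_edges T" using yz by (simp add: root_edges_def)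
        obtain c where c: "{y, z} = {rt T, c}" "c \<in> verts (upper T {y, z})" "c \<noteq> rt T"
          using root_edge_eq[OF T r] by metis
        then have "z = c" using True by (auto simp: doubleton_eq_iff)
        with c r show ?thesis by blast
      next
        case False
        with step.IH obtain r where r: "r \<in> root_edges T" "y \<in> verts (upper T r)" by blast
        then have rT: "r \<in> edges T" "rt T \<in> r" by (simp_all add: root_edges_def)
        have "{y, z} \<in> edges (upper T r)"
          using rT False z r(2) by (intro edge_in_upper[OF T rT(1) yz]) auto
        then show ?thesis
          using edge_subset_verts[OF rooted_tree_upper[OF T rT(1)]] r(1) by blast
      qed
    qed
  qed simp
  with v(2) show ?thesis by blast
qed

lemma edges_partition:
  assumes T: "rooted_tree T"
  shows "edges T = root_edges T \<union> (\<Union>r\<in>root_edges T. edges (upper T r))"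
proof (intro equalityI subsetI)
  fix e assume e: "e \<in> edges T"
  show "e \<in> root_edges T \<union> (\<Union>r\<in>root_edges T. edges (upper T r))"
  proof (cases "rt T \<in> e")
    case True
    with e show ?thesis by (simp add: root_edges_def)
  next
    case False
    from edge_subset_verts[OF T e] obtain x where x: "x \<in> e" "x \<in> verts T" by blast
    with False obtain r where r: "r \<in> root_edges T" "x \<in> verts (upper T r)"
      using branches_cover[OF T] by metis
    then have "e \<in> edges (upper T r)"
      using False x by (intro edge_in_upper[OF T _ e]) (auto simp: root_edges_def)
    with r show ?thesis by blast
  qed
next
  fix e assume "e \<in> root_edges T \<union> (\<Union>r\<in>root_edges T. edges (upper T r))"
  then show "e \<in> edges T"
    using is_graft_lower_upper[OF T] by (auto simp: is_graft_def root_edges_def)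
qed

text \<open>The root of a branch is adjacent to the root of \<open>T\<close>; a second vertex of the branch at
  distance at most 1 would be the root of another branch, which is disjoint from this one.\<close>

lemma branch_root_unique_nearest:
  assumes T: "rooted_tree T" and r: "r \<in> root_edges T" and v: "v \<in> verts (upper T r)"
  shows "(\<forall>u\<in>verts (upper T r). u \<noteq> v \<longrightarrow> graph_dist T (rt T) v < graph_dist T (rt T) u)
    \<longleftrightarrow> v = rt (upper T r)" (is "?nearest v \<longleftrightarrow> _")
proof -
  let ?c = "rt (upper T r)" and ?d = "graph_dist T (rt T)"
  have rT: "r \<in> edges T" using r by (simp add: root_edges_def)
  obtain c where c: "?c = c" "r = {rt T, c}" "c \<in> verts (upper T r)"
    using root_edge_eq[OF T r] .
  have cV: "?c \<in> verts (upper T r)" unfolding c(1) by (fact c(3))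
  have "{rt T, ?c} \<in> edges T" unfolding c(1) using rT c(2) by metis
  then have "(rt T, ?c) \<in> adj T" by (simp add: adj_def)
  then have c: "?d ?c \<le> 1" unfolding graph_dist_def by (intro Least_le) simp
  have far: "1 < ?d u" if u: "u \<in> verts (upper T r)" "u \<noteq> ?c" for u
  proof (rule ccontr)
    assume "\<not> 1 < ?d u"
    then consider "?d u = 0" | "?d u = 1" by linarith
    moreover have "u \<in> verts T" using u(1) by (simp add: verts_upper)
    then have "(rt T, u) \<in> (adj T)\<^sup>*" using T by (auto simp: rooted_tree_def connected_graph_def)
    then have d: "(rt T, u) \<in> adj T ^^ ?d u"
      unfolding graph_dist_def rtrancl_power by (rule LeastI_ex)
    have ne: "u \<noteq> rt T" using u(1) root_notin_upper[OF T rT] by auto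
    ultimately show False
    proof cases
      case 1
      with d ne show False by simp
    next
      case 2
      with d have s: "{rt T, u} \<in> root_edges T" by (simp add: adj_def root_edges_def)
      obtain w where w: "rt (upper T {rt T, u}) = w" "{rt T, u} = {rt T, w}"
          "w \<in> verts (upper T {rt T, u})" "w \<noteq> rt T"
        using root_edge_eq[OF T s] .
      from w(2,4) have "w = u" by (auto simp: doubleton_eq_iff)
      with w(1,3) have eq: "rt (upper T {rt T, u}) = u" "u \<in> verts (upper T {rt T, u})" by simp_all
      with u(1) branches_disjoint(1)[OF T r s] have "r = {rt T, u}" by blast
      with eq(1) u(2) show False by simp
    qed
  qed
  show ?thesis
  proof
    assume "?nearest v"
    show "v = ?c"
    proof (rule ccontr)
      assume "v \<noteq> ?c"
      then have "1 < ?d v" by (rule far[OF v])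
      moreover have "?d v < ?d ?c" using \<open>?nearest v\<close> cV \<open>v \<noteq> ?c\<close> by metis
      ultimately show False using c by simp
    qed
  next
    assume "v = ?c"
    show "?nearest v"
    proof (intro ballI impI)
      fix u assume "u \<in> verts (upper T r)" "u \<noteq> v"
      then have "1 < ?d u" using far \<open>v = ?c\<close> by simp
      then show "?d v < ?d u" using c \<open>v = ?c\<close> by simp
    qed
  qed
qed

lemma component_of_delete_root:
  assumes T: "rooted_tree T" and r: "r \<in> root_edges T" and x: "x \<in> verts (upper T r)"
  shows "component_of (delete_vertex T (rt T)) x
    = \<lparr>verts = verts (upper T r), edges = edges (upper T r)\<rparr>"
proof (rule component_of_eq)
  have rT: "r \<in> edges T" and "rt T \<in> r" using r by (auto simp: root_edges_def)
  have U: "rooted_tree (upper T r)" using rooted_tree_upper[OF T rT] .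
  note gr = is_graft_lower_upper[OF T rT] and nr = root_notin_upper[OF T rT]
  show "simple_graph (delete_vertex T (rt T))"
    using T by (intro simple_delete_vertex) (simp add: rooted_tree_def)
  show "simple_graph (upper T r)" "connected_graph (upper T r)"
    using U by (simp_all add: rooted_tree_def)
  show "verts (upper T r) \<subseteq> verts (delete_vertex T (rt T))"
    using gr nr by (auto simp: is_graft_def delete_vertex_def)
  show "edges (upper T r) \<subseteq> edges (delete_vertex T (rt T))"
    using gr nr edge_subset_verts[OF U] by (auto simp: is_graft_def delete_vertex_def)
  show "x \<in> verts (upper T r)" by fact
  show "f \<in> edges (upper T r)"
    if "f \<in> edges (delete_vertex T (rt T))" "f \<inter> verts (upper T r) \<noteq> {}" for f
    using that \<open>rt T \<in> r\<close> by (intro edge_in_upper[OF T rT]) (auto simp: delete_vertex_def)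
qed

lemma component_trees_delete_root:
  assumes T: "rooted_tree T"
  shows "component_trees (delete_root T) = upper T ` root_edges T"
proof -
  let ?G = "delete_vertex T (rt T)"
  let ?C = "\<lambda>r. \<lparr>verts = verts (upper T r), edges = edges (upper T r)\<rparr>"
  have "graph_components (delete_root T) = graph_components ?G"
    by (simp add: graph_components_def component_of_def delete_root_def adj_def Let_def)
  also have comps_G: "graph_components ?G = ?C ` root_edges T"
  proof (intro equalityI subsetI)
    fix C assume "C \<in> graph_components ?G"
    then obtain x where x: "x \<in> verts T" "x \<noteq> rt T" "C = component_of ?G x"
      by (auto simp: graph_components_def delete_vertex_def)
    with branches_cover[OF T] component_of_delete_root[OF T] show "C \<in> ?C ` root_edges T"
      by blast
  next
    fix C assume "C \<in> ?C ` root_edges T"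
    then obtain r where r: "r \<in> root_edges T" "C = ?C r" by blast
    have rT: "r \<in> edges T" using r by (simp add: root_edges_def)
    have c: "rt (upper T r) \<in> verts (upper T r)"
      using is_graft_lower_upper[OF T rT] by (simp add: is_graft_def)
    then have "rt (upper T r) \<in> verts ?G"
      using root_notin_upper[OF T rT] by (auto simp: delete_vertex_def verts_upper)
    with component_of_delete_root[OF T r(1) c] r(2) show "C \<in> graph_components ?G"
      unfolding graph_components_def by (intro image_eqI) simp_all
  qed
  finally have comps: "graph_components (delete_root T) = ?C ` root_edges T" .
  have rt_in: "rt (upper T r) \<in> verts (upper T r)" if "r \<in> root_edges T" for r
    using is_graft_lower_upper[OF T root_edges_subset[OF that]] by (simp add: is_graft_def)
  have rt_eq: "r = s" if "r \<in> root_edges T" "s \<in> root_edges T" "rt (upper T s) \<in> verts (upper T r)" for r s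
    using branches_disjoint(1)[OF T that(1,2)] rt_in[OF that(2)] that(3) by blast
  have roots: "roots (delete_root T) = (\<lambda>r. rt (upper T r)) ` root_edges T"
  proof (intro equalityI subsetI)
    fix v assume "v \<in> roots (delete_root T)"
    then obtain r where r: "r \<in> root_edges T" "v \<in> verts (upper T r)"
      "\<forall>u\<in>verts (upper T r). u \<noteq> v \<longrightarrow> graph_dist T (rt T) v < graph_dist T (rt T) u"
      by (auto simp: delete_root_def Let_def comps_G)
    then have "v = rt (upper T r)" using branch_root_unique_nearest[OF T r(1,2)] by simp
    with r(1) show "v \<in> (\<lambda>r. rt (upper T r)) ` root_edges T" by (rule rev_image_eqI)
  next
    fix v assume "v \<in> (\<lambda>r. rt (upper T r)) ` root_edges T"
    then obtain r where r: "r \<in> root_edges T" "v = rt (upper T r)" by blast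
    then show "v \<in> roots (delete_root T)"
      using branch_root_unique_nearest[OF T r(1) rt_in[OF r(1)]] rt_in[OF r(1)]
      by (simp add: delete_root_def Let_def comps_G) blast
  qed
  have C: "rooted_at (?C r) (rt (upper T r)) = upper T r" for r
    by (simp add: rooted_at_def)
  show ?thesis
  proof (intro equalityI subsetI)
    fix S assume "S \<in> component_trees (delete_root T)"
    then obtain r v where S: "r \<in> root_edges T" "S = rooted_at (?C r) v"
        "v \<in> roots (delete_root T)" "v \<in> verts (upper T r)"
      unfolding component_trees_def comps by auto
    then obtain s where s: "s \<in> root_edges T" "v = rt (upper T s)" unfolding roots by blast
    with S rt_eq have "s = r" by blast
    with s(2) S(2) C have "S = upper T r" by simp
    with S(1) show "S \<in> upper T ` root_edges T" by (rule rev_image_eqI)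
  next
    fix S assume "S \<in> upper T ` root_edges T"
    then obtain r where r: "r \<in> root_edges T" "S = upper T r" by blast
    then have "S = rooted_at (?C r) (rt (upper T r))" using C by simp
    moreover have "rt (upper T r) \<in> roots (delete_root T)" unfolding roots using r(1) by blast
    moreover have "rt (upper T r) \<in> verts (?C r)" using rt_in[OF r(1)] by simp
    moreover have "?C r \<in> graph_components (delete_root T)" unfolding comps using r(1) by blast
    ultimately show "S \<in> component_trees (delete_root T)" unfolding component_trees_def by blast
  qed
qed

lemma inj_on_upper_root_edges:
  assumes T: "rooted_tree T"
  shows "inj_on (upper T) (root_edges T)"
proof (rule inj_onI)
  fix r s assume rs: "r \<in> root_edges T" "s \<in> root_edges T" "upper T r = upper T s"
  have "verts (upper T s) \<noteq> {}"
    using is_graft_lower_upper[OF T root_edges_subset[OF rs(2)]] by (auto simp: is_graft_def)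
  with rs branches_disjoint(1)[OF T rs(1,2)] show "r = s" by auto
qed


section \<open>The derivative of \<open>\<psi>\<^sub>T\<close>\<close>

text \<open>The inner sum of the recursion for \<open>\<phi>\<^sub>T\<close> with \<open>k\<close> counting the edges of the sequence, one
  less than the trees it determines.\<close>

definition cut_sum :: "'a rooted_graph \<Rightarrow> nat \<Rightarrow> rat" where
  "cut_sum T k = (\<Sum>es\<in>edge_seqs T k. prod_list (map tree_phi (cut_trees T es)))"

lemma edge_seqs_Suc:
  assumes T: "rooted_tree T"
  shows "edge_seqs T (Suc k) = (\<Union>e\<in>edges T. (#) e ` edge_seqs (lower T e) k)"
proof -
  have "e # es \<in> edge_seqs T (Suc k) \<longleftrightarrow> e \<in> edges T \<and> es \<in> edge_seqs (lower T e) k" for e es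
  proof (cases "e \<in> edges T \<and> set es \<subseteq> edges (lower T e)")
    case True
    then have e: "e \<in> edges T" and sub: "set es \<subseteq> edges (lower T e)" by auto
    have eq: "edge_succ T f g \<longleftrightarrow> edge_succ (lower T e) f g" if "f \<in> set es" "g \<in> set es" for f g
      using lower_lower_edges[OF T e, of f g] that sub by (auto simp: edge_succ_def)
    have "sorted_wrt (edge_succ T) es \<longleftrightarrow> sorted_wrt (edge_succ (lower T e)) es"
      using sorted_wrt_mono_rel[of es "edge_succ T" "edge_succ (lower T e)"]
        sorted_wrt_mono_rel[of es "edge_succ (lower T e)" "edge_succ T"] eq by blast
    moreover have "set es \<subseteq> edges T"
      using sub is_graft_lower_upper[OF T e] by (auto simp: is_graft_def)
    ultimately show ?thesis using e sub by (auto simp: edge_seqs_def edge_succ_def)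
  next
    case False
    then show ?thesis by (auto simp: edge_seqs_def edge_succ_def)
  qed
  note Cons_iff = this
  show ?thesis
  proof (intro equalityI subsetI)
    fix es assume es: "es \<in> edge_seqs T (Suc k)"
    then obtain e es' where "es = e # es'" by (auto simp: edge_seqs_def length_Suc_conv)
    with es Cons_iff[of e es'] show "es \<in> (\<Union>e\<in>edges T. (#) e ` edge_seqs (lower T e) k)" by blast
  next
    fix es assume "es \<in> (\<Union>e\<in>edges T. (#) e ` edge_seqs (lower T e) k)"
    with Cons_iff show "es \<in> edge_seqs T (Suc k)" by blast
  qed
qed

lemma finite_edge_seqs: "rooted_tree T \<Longrightarrow> finite (edge_seqs T k)"
  by (rule finite_subset[OF _ finite_lists_length_eq[OF finite_edges[of T], of k]])
    (auto simp: edge_seqs_def)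

lemma cut_sum_0: "cut_sum T 0 = tree_phi T"
proof -
  have "edge_seqs T 0 = {[]}" by (auto simp: edge_seqs_def)
  then show ?thesis by (simp add: cut_sum_def)
qed

lemma cut_sum_Suc:
  assumes T: "rooted_tree T"
  shows "cut_sum T (Suc k) = (\<Sum>e\<in>edges T. tree_phi (upper T e) * cut_sum (lower T e) k)"
proof -
  have "cut_sum T (Suc k) = (\<Sum>e\<in>edges T. \<Sum>es\<in>(#) e ` edge_seqs (lower T e) k.
      prod_list (map tree_phi (cut_trees T es)))"
    unfolding cut_sum_def edge_seqs_Suc[OF T]
  proof (rule sum.UNION_disjoint)
    show "finite (edges T)" using T by (rule finite_edges)
    show "\<forall>e\<in>edges T. finite ((#) e ` edge_seqs (lower T e) k)"
      using finite_edge_seqs rooted_tree_lower[OF T] by blast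
  qed auto
  also have "\<dots> = (\<Sum>e\<in>edges T. tree_phi (upper T e) * cut_sum (lower T e) k)"
    by (simp add: sum.reindex cut_sum_def sum_distrib_left)
  finally show ?thesis .
qed

text \<open>Hence the bound on the summation index in the definition of \<open>\<psi>\<^sub>T\<close> can be ignored when
  coefficients are compared.\<close>

lemma cut_sum_eq_0: "rooted_tree T \<Longrightarrow> vcount T \<le> k \<Longrightarrow> cut_sum T k = 0"
proof (induction k arbitrary: T)
  case 0
  then show ?case by (auto simp: vcount_def rooted_tree_def)
next
  case (Suc k)
  have "cut_sum (lower T e) k = 0" if "e \<in> edges T" for e
    using Suc.prems vcount_lower_less[of T e] rooted_tree_lower[of T e] that
    by (intro Suc.IH) auto
  then show ?case by (simp add: cut_sum_Suc Suc.prems)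
qed

lemma coeff_tree_psi:
  assumes T: "rooted_tree T"
  shows "coeff (tree_psi T) 0 = 0" "coeff (tree_psi T) (Suc n) = cut_sum T n / fact (Suc n)"
proof -
  have *: "coeff (tree_psi T) m = (\<Sum>k = 1..vcount T. if k = m then cut_sum T (k - 1) / fact k else 0)" for m
    by (simp add: tree_psi_def coeff_sum cut_sum_def)
  show "coeff (tree_psi T) 0 = 0" unfolding * by (simp add: sum.delta)
  show "coeff (tree_psi T) (Suc n) = cut_sum T n / fact (Suc n)"
    unfolding * using cut_sum_eq_0[OF T, of n] by (simp add: sum.delta del: fact_Suc)
qed

lemma pderiv_tree_psi:
  assumes T: "rooted_tree T"
  shows "pderiv (tree_psi T) =
    [:tree_phi T:] + (\<Sum>e\<in>edges T. smult (tree_phi (upper T e)) (tree_psi (lower T e)))"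
proof (rule poly_eqI)
  fix n
  have "coeff (pderiv (tree_psi T)) n = cut_sum T n / fact n"
    by (simp add: coeff_pderiv coeff_tree_psi[OF T] del: of_nat_Suc)
  also have "\<dots> = coeff ([:tree_phi T:] +
      (\<Sum>e\<in>edges T. smult (tree_phi (upper T e)) (tree_psi (lower T e)))) n"
  proof (cases n)
    case 0
    then show ?thesis
      using rooted_tree_lower[OF T] by (simp add: cut_sum_0 coeff_sum coeff_tree_psi)
  next
    case (Suc m)
    then show ?thesis
      using rooted_tree_lower[OF T]
      by (simp add: cut_sum_Suc[OF T] coeff_sum coeff_tree_psi sum_divide_distrib del: fact_Suc)
  qed
  finally show "coeff (pderiv (tree_psi T)) n = coeff ([:tree_phi T:] +
      (\<Sum>e\<in>edges T. smult (tree_phi (upper T e)) (tree_psi (lower T e)))) n" .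
qed

lemma poly_tree_psi_0: "rooted_tree T \<Longrightarrow> poly (tree_psi T) 0 = 0"
  by (simp add: poly_0_coeff_0 coeff_tree_psi)

text \<open>For \<open>v(T) \<ge> 2\<close> this is the recursion for \<open>\<phi>\<^sub>T\<close>, whose left-hand side is the term of
  \<open>\<psi>\<^sub>T(1)\<close> missing from the sum on its right-hand side.\<close>

lemma poly_tree_psi_1:
  assumes T: "rooted_tree T"
  shows "poly (tree_psi T) 1 = (if vcount T = 1 then 1 else 0)"
proof -
  have psi: "poly (tree_psi T) 1 = (\<Sum>k = 1..vcount T. 1 / fact k * cut_sum T (k - 1))"
    by (simp add: tree_psi_def poly_sum poly_monom cut_sum_def)
  show ?thesis
  proof (cases "vcount T = 1")
    case True
    then have "tree_phi T = 1" using T by (subst tree_phi.simps) simp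
    with True show ?thesis by (simp add: psi cut_sum_0)
  next
    case False
    then have "1 \<le> vcount T" using T by (auto simp: vcount_def rooted_tree_def Suc_le_eq card_gt_0_iff)
    then have "poly (tree_psi T) 1 = tree_phi T + (\<Sum>k = 2..vcount T. 1 / fact k * cut_sum T (k - 1))"
      unfolding psi by (subst sum.atLeast_Suc_atMost) (simp_all add: cut_sum_0 numeral_2_eq_2)
    also have "tree_phi T = - (\<Sum>k = 2..vcount T. 1 / fact k * cut_sum T (k - 1))"
      using T False by (subst tree_phi.simps) (simp add: cut_sum_def)
    finally show ?thesis using False by simp
  qed
qed


section \<open>The forward difference of \<open>\<psi>\<^sub>T\<close>\<close>

lemma pderiv_forward_diff: "pderiv (forward_diff p) = forward_diff (pderiv p)"
  by (simp add: forward_diff_def pderiv_diff pderiv_pcompose pderiv_pCons)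

lemma forward_diff_const_add_sum:
  "forward_diff ([:c:] + (\<Sum>i\<in>I. smult (a i) (f i))) = (\<Sum>i\<in>I. smult (a i) (forward_diff (f i)))"
  by (simp add: forward_diff_def pcompose_add pcompose_sum pcompose_smult smult_diff_right
      sum_subtractf pcompose_const)

lemma poly_eq_by_pderiv:
  fixes p q :: "'a :: {idom, semiring_char_0} poly"
  assumes "pderiv p = pderiv q" "poly p 0 = poly q 0"
  shows "p = q"
proof -
  have "pderiv (p - q) = 0" using assms(1) by (simp add: pderiv_diff)
  then obtain h where "p - q = [:h:]" using pderiv_iszero by blast
  moreover have "poly (p - q) 0 = 0" using assms(2) by simp
  ultimately show ?thesis by simp
qed

definition branch_psi :: "'a rooted_graph \<Rightarrow> rat poly" where
  "branch_psi T = (\<Prod>r\<in>root_edges T. tree_psi (upper T r))"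

lemma branch_psi_lower_root_edge:
  assumes T: "rooted_tree T" and r: "r \<in> root_edges T"
  shows "branch_psi (lower T r) = (\<Prod>s\<in>root_edges T - {r}. tree_psi (upper T s))"
proof -
  have rT: "r \<in> edges T" using r by (rule root_edges_subset)
  have "upper (lower T r) s = upper T s" if s: "s \<in> root_edges T - {r}" for s
  proof (rule upper_lower_eq[OF T rT])
    show "s \<in> edges (lower T r)"
      using s root_edges_lower[OF T rT] root_edges_subset by blast
    show "r \<notin> edges (upper T s)"
      using s root_edge_notin_upper[OF T r] root_edges_subset by blast
  qed
  then show ?thesis by (simp add: branch_psi_def root_edges_lower[OF T rT])
qed

text \<open>Cutting an edge of one branch cuts that branch and leaves the others as they are.\<close>

lemma branch_psi_lower_branch_edge:
  assumes T: "rooted_tree T" and r: "r \<in> root_edges T" and e: "e \<in> edges (upper T r)"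
  shows "branch_psi (lower T e) =
    tree_psi (lower (upper T r) e) * (\<Prod>s\<in>root_edges T - {r}. tree_psi (upper T s))"
proof -
  have rT: "r \<in> edges T" using r by (rule root_edges_subset)
  have eT: "e \<in> edges T" using is_graft_lower_upper[OF T rT] e by (simp add: is_graft_def)
  have R: "root_edges (lower T e) = root_edges T"
    using root_edges_lower[OF T eT] root_edge_notin_upper[OF T _ rT] e by blast
  have "upper (lower T e) s = upper T s" if s: "s \<in> root_edges T - {r}" for s
  proof (rule upper_lower_eq[OF T eT])
    show "s \<in> edges (lower T e)" using s R root_edges_subset by blast
    show "e \<notin> edges (upper T s)" using s e branches_disjoint(2)[OF T r, of s] by blast
  qed
  moreover have "upper (lower T e) r = lower (upper T r) e" using cut_nested(4)[OF T rT e] .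
  ultimately show ?thesis
    by (simp add: branch_psi_def R prod.remove[OF finite_root_edges[OF T] r])
qed

text \<open>By the product rule, the factor of the branch at \<open>r\<close> contributes the constant \<open>\<phi>\<close> of this
  branch, which accounts for the edge \<open>r\<close>, and one summand for each edge inside the branch. By
  \<open>edges_partition\<close> these are all edges of \<open>T\<close>.\<close>

lemma pderiv_branch_psi:
  assumes T: "rooted_tree T"
  shows "pderiv (branch_psi T) =
    (\<Sum>e\<in>edges T. smult (tree_phi (upper T e)) (branch_psi (lower T e)))"
proof -
  let ?g = "\<lambda>e. smult (tree_phi (upper T e)) (branch_psi (lower T e))"
  have "(\<Prod>s\<in>root_edges T - {r}. tree_psi (upper T s)) * pderiv (tree_psi (upper T r))
      = ?g r + (\<Sum>e\<in>edges (upper T r). ?g e)" if r: "r \<in> root_edges T" for r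
  proof -
    have rT: "r \<in> edges T" using r by (rule root_edges_subset)
    let ?P = "\<Prod>s\<in>root_edges T - {r}. tree_psi (upper T s)"
    have "smult (tree_phi (upper (upper T r) e)) (?P * tree_psi (lower (upper T r) e)) = ?g e"
      if e: "e \<in> edges (upper T r)" for e
      using branch_psi_lower_branch_edge[OF T r e] cut_nested(2)[OF T rT e] by (simp add: mult.commute)
    moreover have "smult (tree_phi (upper T r)) ?P = ?g r"
      using branch_psi_lower_root_edge[OF T r] by simp
    ultimately show ?thesis
      using rooted_tree_upper[OF T rT]
      by (simp add: pderiv_tree_psi distrib_left sum_distrib_left)
  qed
  then have "pderiv (branch_psi T) =
      (\<Sum>r\<in>root_edges T. ?g r) + (\<Sum>r\<in>root_edges T. \<Sum>e\<in>edges (upper T r). ?g e)"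
    by (simp add: branch_psi_def pderiv_prod sum.distrib)
  also have "(\<Sum>r\<in>root_edges T. \<Sum>e\<in>edges (upper T r). ?g e)
      = (\<Sum>e\<in>(\<Union>r\<in>root_edges T. edges (upper T r)). ?g e)"
  proof (rule sum.UNION_disjoint[symmetric])
    show "finite (root_edges T)" using T by (rule finite_root_edges)
    show "\<forall>r\<in>root_edges T. finite (edges (upper T r))"
      using finite_edges rooted_tree_upper[OF T] root_edges_subset by blast
    show "\<forall>r\<in>root_edges T. \<forall>s\<in>root_edges T. r \<noteq> s \<longrightarrow> edges (upper T r) \<inter> edges (upper T s) = {}"
      using branches_disjoint(2)[OF T] by blast
  qed
  also have "(\<Sum>r\<in>root_edges T. ?g r) + \<dots> = (\<Sum>e\<in>edges T. ?g e)"
  proof -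
    let ?B = "\<Union>r\<in>root_edges T. edges (upper T r)"
    have "root_edges T \<inter> ?B = {}"
      using root_edge_notin_upper[OF T] root_edges_subset by blast
    moreover have "finite (root_edges T)" "finite ?B"
      using finite_edges[OF T] edges_partition[OF T] by (metis finite_Un)+
    ultimately show ?thesis
      unfolding edges_partition[OF T] by (simp add: sum.union_disjoint)
  qed
  finally show ?thesis .
qed

lemma root_edges_empty_iff:
  assumes T: "rooted_tree T"
  shows "root_edges T = {} \<longleftrightarrow> vcount T = 1"
proof
  assume "root_edges T = {}"
  then have "verts T = {rt T}" using branches_cover[OF T] T by (auto simp: rooted_tree_def)
  then show "vcount T = 1" by (simp add: vcount_def)
next
  assume "vcount T = 1"
  then have "verts T = {rt T}" using T by (auto simp: vcount_def card_1_singleton_iff rooted_tree_def)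
  then have "card e \<le> 1" if "e \<in> edges T" for e
    using edge_subset_verts[OF T that] card_mono[of "verts T" e] by simp
  moreover have "card e = 2" if "e \<in> edges T" for e
    using T that by (simp add: rooted_tree_def simple_graph_def)
  ultimately show "root_edges T = {}" by (force simp: root_edges_def)
qed

lemma poly_branch_psi_0:
  assumes T: "rooted_tree T"
  shows "poly (branch_psi T) 0 = (if vcount T = 1 then 1 else 0)"
proof (cases "root_edges T = {}")
  case True
  then show ?thesis using root_edges_empty_iff[OF T] by (simp add: branch_psi_def)
next
  case False
  then obtain r where "r \<in> root_edges T" by blast
  moreover from this have "poly (tree_psi (upper T r)) 0 = 0"
    by (intro poly_tree_psi_0 rooted_tree_upper T root_edges_subset)
  ultimately have "poly (branch_psi T) 0 = 0"
    using finite_root_edges[OF T] by (auto simp: branch_psi_def poly_prod)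
  with False show ?thesis using root_edges_empty_iff[OF T] by simp
qed

lemma forward_diff_tree_psi:
  "rooted_tree T \<Longrightarrow> forward_diff (tree_psi T) = branch_psi T"
proof (induction "vcount T" arbitrary: T rule: less_induct)
  case less
  note T = less.prems
  have "pderiv (forward_diff (tree_psi T)) =
      (\<Sum>e\<in>edges T. smult (tree_phi (upper T e)) (forward_diff (tree_psi (lower T e))))"
    by (simp add: pderiv_forward_diff pderiv_tree_psi[OF T] forward_diff_const_add_sum
        del: pCons_0_0 add_pCons)
  also have "\<dots> = (\<Sum>e\<in>edges T. smult (tree_phi (upper T e)) (branch_psi (lower T e)))"
    using less.hyps vcount_lower_less[OF T] rooted_tree_lower[OF T] by simp
  also have "\<dots> = pderiv (branch_psi T)" by (rule pderiv_branch_psi[OF T, symmetric])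
  finally show ?case
  proof (rule poly_eq_by_pderiv)
    show "poly (forward_diff (tree_psi T)) 0 = poly (branch_psi T) 0"
      by (simp add: forward_diff_def poly_pcompose poly_tree_psi_0[OF T] poly_tree_psi_1[OF T]
          poly_branch_psi_0[OF T])
  qed
qed

theorem theorem4p2:
  fixes T :: "'a rooted_graph"
  assumes "rooted_tree T" and "vcount T \<ge> 2"
  shows "forward_diff (tree_psi T) = (\<Prod>S\<in>component_trees (delete_root T). tree_psi S)
     \<and> (\<Prod>S\<in>component_trees (delete_root T). tree_psi S) = forest_psi (delete_root T)"
proof
  have "(\<Prod>S\<in>component_trees (delete_root T). tree_psi S) = branch_psi T"
    using inj_on_upper_root_edges[OF assms(1)]
    by (simp add: component_trees_delete_root[OF assms(1)] prod.reindex branch_psi_def)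
  then show "forward_diff (tree_psi T) = (\<Prod>S\<in>component_trees (delete_root T). tree_psi S)"
    using forward_diff_tree_psi[OF assms(1)] by simp
qed (simp add: forest_psi_def)

end
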